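(* Let $n\ge 1$ be an integer, let $\mathcal{P},\mathcal{N}$ be disjoint subsets of $\{1,\dots,n\}$ with $|\mathcal{P}|+|\mathcal{N}|=n$, and let $S$ and $\mathbb{S}^{n,n}_S$ be the associated sign matrix and sign-constrained Stiefel manifold (case $r=n$). For any matrix $X\in\mathbb{R}^{n\times n}$, $$\operatorname{dist}(X,\mathbb{S}^{n,n}_S)\;\le\;9n\left(\|(S\circ X)_-\|_F+\|\sigma(X)-\mathbf{1}\|_2\right).$$ Moreover, if $\|(S\circ X)_-\|_F+\|\sigma(X)-\mathbf{1}\|_2<1/(4\sqrt n)$, then $$\operatorname{dist}(X,\mathbb{S}^{n,n}_S)\;\le\;8\sqrt n\left(\|(S\circ X)_-\|_F+\|\sigma(X)-\mathbf{1}\|_2\right).$$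
   Context: The sign matrix $S\in\mathbb{R}^{n\times n}$ is defined by $S_{i,j}=1$ if $j\in\mathcal{P}$, $S_{i,j}=-1$ if $j\in\mathcal{N}$, and $S_{i,j}=0$ otherwise ($1\le i\le n$). $\circ$ is the Hadamard (entry-wise) product. The sign-constrained Stiefel manifold is $\mathbb{S}^{n,n}_S=\{X\in\mathbb{R}^{n\times n}: S\circ X\ge 0,\ X^{T}X=I_n\}$, where $\ge$ is entry-wise. For a matrix $Y$, $Y_-=\max\{-Y,0\}$ entry-wise. $\sigma(X)\in\mathbb{R}^n$ is the vector of singular values of $X$ in descending order, $\mathbf{1}$ is the all-ones vector, $\|\cdot\|_2$ is the Euclidean norm for vectors, $\|\cdot\|_F$ is the Frobenius norm, and $\operatorname{dist}(X,\mathcal{T})$ is the distance from $X$ to the set $\mathcal{T}$ in the Frobenius norm. *)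

theory Defs
  imports
    "HOL-Analysis.Analysis"
    "HOL-Computational_Algebra.Computational_Algebra"
begin

text \<open>
  A matrix \<open>A :: real ^ 'c ^ 'r\<close> has rows indexed by \<open>'r\<close> and columns indexed by \<open>'c\<close>, and its
  \<open>(i, j)\<close> entry is \<open>A $ i $ j\<close>. On this type the library operations \<open>*\<close>, \<open>\<le>\<close> and \<open>norm\<close> are the
  Hadamard product, the entry-wise order and the Frobenius norm (the matrix product is \<open>**\<close>);
  the lemmas below spell this out. Consequently \<open>infdist\<close> is the Frobenius distance to a set.
\<close>

lemma hadamard_nth: "(A * B) $ i $ j = A $ i $ j * B $ i $ j"
  for A B :: "real ^ 'c ^ 'r"
  by simp

lemma matrix_nonneg_iff: "0 \<le> A \<longleftrightarrow> (\<forall>i j. 0 \<le> A $ i $ j)"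
  for A :: "real ^ 'c ^ 'r"
  by (simp add: less_eq_vec_def)

lemma norm_matrix_eq_frobenius: "norm A = sqrt (\<Sum>i\<in>UNIV. \<Sum>j\<in>UNIV. (A $ i $ j)\<^sup>2)"
  for A :: "real ^ 'c ^ 'r"
  by (simp add: norm_vec_def L2_set_def sum_nonneg)

definition sign_matrix :: "'c set \<Rightarrow> 'c set \<Rightarrow> real ^ 'c ^ 'r" where
  "sign_matrix P N = (\<chi> i j. if j \<in> P then 1 else if j \<in> N then -1 else 0)"

definition sign_stiefel :: "real ^ 'c ^ 'r \<Rightarrow> (real ^ 'c ^ 'r) set" where
  "sign_stiefel S = {X. S * X \<ge> 0 \<and> transpose X ** X = mat 1}"

definition matrix_neg_part :: "real ^ 'c ^ 'r \<Rightarrow> real ^ 'c ^ 'r" where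
  "matrix_neg_part Y = (\<chi> i j. max (- (Y $ i $ j)) 0)"

definition charpoly :: "real ^ 'n ^ 'n \<Rightarrow> real poly" where
  "charpoly A = det (\<chi> i j. (if i = j then [:0, 1:] else 0) - [:A $ i $ j:])"

text \<open>
  The singular values of \<open>X\<close> are the square roots of the eigenvalues of \<open>X\<^sup>T X\<close>, repeated according to
  multiplicity. In the vector of singular values the entry at the \<open>k\<close>-th smallest index is the
  \<open>k\<close>-th largest singular value; this is what the linear order on the index type is for.
\<close>

definition singular_value_mset :: "real ^ 'n ^ 'n \<Rightarrow> real multiset" where
  "singular_value_mset X = image_mset sqrt (proots (charpoly (transpose X ** X)))"

definition singular_values ::
  "real ^ 'n::{finite, linorder} ^ 'n::{finite, linorder} \<Rightarrow> real ^ 'n::{finite, linorder}" where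
  "singular_values X =
     (\<chi> i. rev (sorted_list_of_multiset (singular_value_mset X)) ! card {j. j < i})"

text \<open>\<open>infdist\<close> to the empty set is \<open>0\<close> by convention; here the set is never empty.\<close>

lemma sign_stiefel_nonempty:
  fixes P N :: "'n::finite set"
  shows "sign_stiefel (sign_matrix P N :: real ^ 'n ^ 'n) \<noteq> {}"
proof -
  define D :: "real ^ 'n ^ 'n" where
    "D = (\<chi> i j. if i = j then if j \<in> P then 1 else -1 else 0)"
  have "transpose D ** D = mat 1"
    by (simp add: D_def vec_eq_iff matrix_matrix_mult_def transpose_def mat_def
        if_distrib[of "\<lambda>x. x * _"] if_distrib[of "\<lambda>x. _ * x"] sum.delta cong: if_cong)
  moreover have "sign_matrix P N * D \<ge> 0"
    by (simp add: matrix_nonneg_iff sign_matrix_def D_def)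
  ultimately show ?thesis
    by (auto simp: sign_stiefel_def)
qed

lemma singular_value_mset_svd:
  fixes U V X :: "real ^ 'n ^ 'n" and d :: "real ^ 'n"
  assumes U: "orthogonal_matrix U" and V: "orthogonal_matrix V" and d: "\<And>i. 0 \<le> d $ i"
    and X: "X = U ** (\<chi> i j. if i = j then d $ i else 0) ** transpose V"
  shows "singular_value_mset X = image_mset (($) d) (mset_set UNIV)"
proof -
  define L where "L = (\<lambda>A :: real ^ 'n ^ 'n. (\<chi> i j. [:A $ i $ j:]) :: real poly ^ 'n ^ 'n)"
  define M where "M = (\<lambda>A :: real ^ 'n ^ 'n. (mat [:0, 1:] - L A :: real poly ^ 'n ^ 'n))"
  define D :: "real ^ 'n ^ 'n" where "D = (\<chi> i j. if i = j then d $ i else 0)"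
  define E :: "real ^ 'n ^ 'n" where "E = (\<chi> i j. if i = j then (d $ i)\<^sup>2 else 0)"
  have cp: "charpoly A = det (M A)" for A :: "real ^ 'n ^ 'n"
    unfolding charpoly_def M_def L_def
    by (rule arg_cong[of _ _ det]) (simp add: vec_eq_iff mat_def)
  have sum_const: "(\<Sum>k\<in>S. [:f k:]) = [:\<Sum>k\<in>S. f k:]" for f :: "'n \<Rightarrow> real" and S
    by (induction S rule: infinite_finite_induct) auto
  have L_mult: "L (A ** B) = L A ** L B" for A B
    by (simp add: L_def vec_eq_iff matrix_matrix_mult_def sum_const mult.commute)
  have L_1: "L (mat 1) = mat 1"
    by (simp add: L_def vec_eq_iff mat_def pCons_one)
  have scal: "A ** mat c = mat c ** A" for A :: "real poly ^ 'n ^ 'n" and c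
    by (simp add: vec_eq_iff matrix_matrix_mult_def mat_def if_distrib[of "\<lambda>x. x * _"]
        if_distrib[of "\<lambda>x. _ * x"] sum.delta sum.delta' mult.commute cong: if_cong)
  have UU: "transpose U ** U = mat 1" and VV: "V ** transpose V = mat 1"
    using U V by (auto simp: orthogonal_matrix_def)
  have DD: "transpose D ** D = E"
    by (simp add: D_def E_def vec_eq_iff matrix_matrix_mult_def transpose_def power2_eq_square
        if_distrib[of "\<lambda>x. x * _"] if_distrib[of "\<lambda>x. _ * x"] sum.delta cong: if_cong)
  have "transpose X ** X = V ** transpose D ** (transpose U ** U) ** D ** transpose V"
    unfolding X D_def[symmetric] by (simp add: matrix_transpose_mul matrix_mul_assoc)
  also have "\<dots> = V ** E ** transpose V"
    by (simp add: UU DD flip: matrix_mul_assoc)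
  finally have XX: "transpose X ** X = V ** E ** transpose V" .
  have VVL: "L V ** L (transpose V) = mat 1"
    by (simp add: L_mult[symmetric] VV L_1)
  have diff1: "A ** (B - C) = A ** B - A ** C" and diff2: "(B - C) ** A = B ** A - C ** A"
    for A B C :: "real poly ^ 'n ^ 'n"
    by (simp_all add: vec_eq_iff matrix_matrix_mult_def algebra_simps sum_subtractf)
  have "L V ** mat [:0, 1:] ** L (transpose V) = mat [:0, 1:] ** (L V ** L (transpose V))"
    by (simp add: scal matrix_mul_assoc)
  hence "M (transpose X ** X) = L V ** M E ** L (transpose V)"
    by (simp add: M_def XX diff1 diff2 L_mult VVL)
  hence "charpoly (transpose X ** X) = det (L V ** L (transpose V)) * det (M E)"
    by (simp add: cp det_mul mult_ac)
  also have "\<dots> = det (M E)"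
    by (simp add: VVL)
  also have "\<dots> = (\<Prod>i\<in>UNIV. M E $ i $ i)"
    by (rule det_diagonal) (simp add: M_def L_def E_def mat_def)
  also have "\<dots> = (\<Prod>i\<in>UNIV. [:- ((d $ i)\<^sup>2), 1:])"
    by (simp add: M_def L_def E_def mat_def)
  finally have "proots (charpoly (transpose X ** X))
      = (\<Sum>i\<in>UNIV. proots [:- ((d $ i)\<^sup>2), 1:])"
    by (simp add: proots_prod)
  also have "\<dots> = (\<Sum>i\<in>UNIV. {#(d $ i)\<^sup>2#})"
    by simp
  also have "\<dots> = image_mset (\<lambda>i. (d $ i)\<^sup>2) (mset_set UNIV)"
    by (simp add: sum_unfold_sum_mset)
  finally show ?thesis
    using d by (simp add: singular_value_mset_def multiset.map_comp o_def)
qed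

end

theory Submission
  imports Defs
begin

text \<open>
  Flipping the sign of the columns indexed by \<open>N\<close> is an isometry for the Frobenius norm and preserves
  orthogonality, so one may think of all signs as positive; the manifold is then the set of
  orthogonal matrices with nonnegative entries, that is, of permutation matrices. Write \<open>n\<close> for the size and \<open>e\<close> for the residual \<open>\<parallel>(S \<circ> X)\<^sub>-\<parallel> + \<parallel>\<sigma>(X) - 1\<parallel>\<close>.

  A singular value decomposition \<open>X = U D V\<^sup>T\<close> gives the orthogonal matrix \<open>Q = U V\<^sup>T\<close> with
  \<open>\<parallel>X - Q\<parallel> = \<parallel>\<sigma>(X) - 1\<parallel>\<close> (lemma \<open>orthogonal_matrix_at_singular_value_distance\<close>). As the negative
  part is 1-Lipschitz, \<open>\<parallel>Q\<^sub>-\<parallel> \<le> e\<close>, and it remains to bound the distance from an orthogonal \<open>Q\<close> with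
  small negative part to a permutation matrix.

  Split \<open>Q = Y - Z\<close> into positive and negative parts, and measure by
  \<open>F\<^sub>i = \<Sum>\<^sub>j\<^sub>\<noteq>\<^sub>i \<langle>\<bar>q\<^sub>i\<bar>, \<bar>q\<^sub>j\<bar>\<rangle>\<close> how much row \<open>i\<close> overlaps the other rows in absolute value. Two estimates
  of \<open>F\<close> are played against each other.

  \<^item> From above: since \<open>\<langle>q\<^sub>i, q\<^sub>j\<rangle> = 0\<close>, only the mixed products survive, and with \<open>w = \<Sum>\<^sub>j z\<^sub>j\<close>, \<open>v = \<Sum>\<^sub>j y\<^sub>j\<close>
  one has exactly \<open>F = 2 (Y w + Z v)\<close>. The vector \<open>w\<close> has norm at most \<open>\<surd>n e\<close>. The vector \<open>v\<close> has norm at most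
  \<open>\<surd>n (1 + e)\<close>, because a sum of \<open>n\<close> orthonormal vectors has norm \<open>\<surd>n\<close>. So \<open>\<parallel>F\<parallel> \<le> 5 \<surd>n e\<close>, which
  is the source of the factor \<open>\<surd>n\<close> in the theorem, and a more careful estimate of single
  entries gives \<open>F\<^sub>i < 1\<close> as soon as \<open>e < 1 / (4 \<surd>n)\<close>
  (lemma \<open>row_overlap_bounds\<close>).

  \<^item> From below: column \<open>k\<close> is a unit vector, so the entries other than \<open>q\<^sub>i\<^sub>k\<close> have absolute sum at
  least \<open>\<surd>(1 - q\<^sub>i\<^sub>k\<^sup>2)\<close>, and \<open>F\<^sub>i \<ge> \<Sum>\<^sub>k \<bar>q\<^sub>i\<^sub>k\<bar> \<surd>(1 - q\<^sub>i\<^sub>k\<^sup>2)\<close>. A unit vector for which this sum is below 1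
  has an entry with square above 1/2, and its distance to the corresponding axis vector, with the sign
  of that entry, is at most the sum (lemma \<open>unit_vector_near_axis\<close>).

  Different rows have their dominant entry in different columns, again because columns are unit
  vectors. So the axis vectors form a permutation matrix at distance at most \<open>\<parallel>F\<parallel>\<close> from \<open>Q\<close>, hence at
  distance at most \<open>5 \<surd>n e + e \<le> 8 \<surd>n e\<close> from \<open>X\<close>.
  If \<open>e \<ge> 1 / (4 \<surd>n)\<close> nothing has to be constructed: orthogonal matrices have norm \<open>\<surd>n\<close>, and
  twice this norm is at most \<open>8 n e\<close>, which together with \<open>\<parallel>X - Q\<parallel> \<le> e\<close> gives \<open>9 n e\<close>.
\<close>

section \<open>Singular value decomposition\<close>

lemma exists_unit_orthogonal_to_family:
  fixes v :: "'n::finite \<Rightarrow> real ^ 'n"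
  assumes "I \<noteq> UNIV"
  obtains u where "norm u = 1" "\<And>i. i \<in> I \<Longrightarrow> v i \<bullet> u = 0"
proof -
  have "dim (v ` I) \<le> card (v ` I)"
    by (simp add: dim_le_card')
  also have "\<dots> \<le> card I"
    by (simp add: card_image_le)
  also have "\<dots> < CARD('n)"
    using assms by (simp add: psubset_card_mono psubset_eq)
  finally have "dim (v ` I) < DIM(real ^ 'n)"
    by simp
  then obtain a where a: "a \<noteq> 0" "span (v ` I) \<subseteq> {x. a \<bullet> x = 0}"
    using lowdim_subset_hyperplane by blast
  show thesis
  proof
    show "norm (a /\<^sub>R norm a) = 1"
      using a by simp
    show "v i \<bullet> (a /\<^sub>R norm a) = 0" if "i \<in> I" for i
    proof -
      have "v i \<in> span (v ` I)" using that by (simp add: span_base)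
      hence "a \<bullet> v i = 0" using a by auto
      thus ?thesis by (simp add: inner_commute)
    qed
  qed
qed

text \<open>
  A maximiser \<open>u\<close> of the Rayleigh quotient on the unit sphere of the subspace is an eigenvector. With
  \<open>c\<close> the maximum, the quadratic form \<open>x \<mapsto> c \<langle>x, x\<rangle> - \<langle>x, A x\<rangle>\<close> is nonnegative on the subspace and vanishes at
  \<open>u\<close>; its first variation at \<open>u\<close> in the direction of the residual \<open>r = c u - A u\<close> is a multiple of
  \<open>\<langle>r, r\<rangle>\<close>, so \<open>r\<close> has to vanish.
\<close>

lemma symmetric_eigenvector_in_invariant_subspace:
  fixes A :: "real ^ 'n ^ 'n"
  assumes sym: "transpose A = A" and S: "subspace S" and inv: "\<And>x. x \<in> S \<Longrightarrow> A *v x \<in> S"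
    and u0: "u0 \<in> S" "norm u0 = 1"
  obtains u c where "u \<in> S" "norm u = 1" "A *v u = c *\<^sub>R u"
proof -
  have adj: "x \<bullet> (A *v y) = (A *v x) \<bullet> y" for x y
    by (metis dot_lmul_matrix inner_commute sym transpose_matrix_vector)
  have "compact (S \<inter> sphere 0 1)"
    by (simp add: S closed_subspace closed_Int_compact)
  moreover have "S \<inter> sphere 0 1 \<noteq> {}"
    using u0 by auto
  moreover have "continuous_on (S \<inter> sphere 0 1) (\<lambda>x. x \<bullet> (A *v x))"
    by (intro continuous_intros linear_continuous_on_compose matrix_vector_mul_linear)
  ultimately obtain u where u: "u \<in> S" "norm u = 1"
    and max: "\<And>x. x \<in> S \<Longrightarrow> norm x = 1 \<Longrightarrow> x \<bullet> (A *v x) \<le> u \<bullet> (A *v u)"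
    using continuous_attains_sup[of "S \<inter> sphere 0 1" "\<lambda>x. x \<bullet> (A *v x)"]
    by (metis IntE IntI mem_sphere_0)
  define c where "c = u \<bullet> (A *v u)"
  have uu: "u \<bullet> u = 1"
    using u by (simp add: norm_eq_1)
  have form: "x \<bullet> (A *v x) \<le> c * (x \<bullet> x)" if "x \<in> S" for x
  proof (cases "x = 0")
    case False
    have "(x /\<^sub>R norm x) \<bullet> (A *v (x /\<^sub>R norm x)) \<le> c"
      unfolding c_def using that False S by (intro max) (auto simp: subspace_scale)
    hence "x \<bullet> (A *v x) / (norm x)\<^sup>2 \<le> c"
      by (simp add: matrix_vector_mult_scaleR field_simps power2_eq_square)
    thus ?thesis
      using False by (simp add: field_simps power2_norm_eq_inner)
  qed simp
  define r where "r = c *\<^sub>R u - A *v u"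
  have rS: "r \<in> S"
    unfolding r_def using S u inv by (intro subspace_diff subspace_scale)
  have ur: "u \<bullet> r = 0"
    by (simp add: r_def inner_diff_right uu c_def)
  have quad: "0 \<le> 2 * t * (r \<bullet> r) + t\<^sup>2 * (c * (r \<bullet> r) - r \<bullet> (A *v r))" for t
  proof -
    have "u + t *\<^sub>R r \<in> S"
      using S u rS by (intro subspace_add subspace_scale)
    from form[OF this] have "0 \<le> c * ((u + t *\<^sub>R r) \<bullet> (u + t *\<^sub>R r)) - (u + t *\<^sub>R r) \<bullet> (A *v (u + t *\<^sub>R r))"
      by simp
    also have "\<dots> = c * (1 + t\<^sup>2 * (r \<bullet> r)) - (c + 2 * t * (r \<bullet> (A *v u)) + t\<^sup>2 * (r \<bullet> (A *v r)))"
      using adj[of u r] ur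
      by (simp add: inner_add_left inner_add_right matrix_vector_right_distrib
          matrix_vector_mult_scaleR uu inner_commute c_def algebra_simps power2_eq_square)
    also have "r \<bullet> (A *v u) = - (r \<bullet> r)"
      using ur by (simp add: r_def inner_diff_right inner_diff_left inner_commute)
    finally show ?thesis
      by (simp add: algebra_simps)
  qed
  have "r \<bullet> r = 0"
  proof (rule ccontr)
    assume "r \<bullet> r \<noteq> 0"
    define a where "a = r \<bullet> r"
    define b where "b = c * (r \<bullet> r) - r \<bullet> (A *v r)"
    have a: "a > 0" using \<open>r \<bullet> r \<noteq> 0\<close> unfolding a_def by simp
    have b: "b \<ge> 0" using form[OF rS] by (simp add: b_def)
    \<comment> \<open>the quadratic in \<open>t\<close> has slope \<open>2 a > 0\<close> at 0, so it is negative at this small negative \<open>t\<close>\<close>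
    define t where "t = - a / (b + 1)"
    have "2 * t * a + t\<^sup>2 * b = (a\<^sup>2 / (b + 1)) * (b / (b + 1) - 2)"
      using b by (simp add: t_def divide_simps power2_eq_square) (simp add: algebra_simps)
    also have "\<dots> < 0"
      using a b by (intro mult_pos_neg) (auto simp: field_simps add_pos_nonneg)
    finally show False
      using quad[of t] by (simp add: a_def b_def)
  qed
  hence "A *v u = c *\<^sub>R u"
    by (simp add: r_def)
  with u show thesis by (rule that)
qed

definition orthonormal_on :: "'i set \<Rightarrow> ('i \<Rightarrow> real ^ 'n) \<Rightarrow> bool" where
  "orthonormal_on I v \<longleftrightarrow> (\<forall>i\<in>I. \<forall>j\<in>I. v i \<bullet> v j = (if i = j then 1 else 0))"

lemma orthonormal_on_insert:
  assumes "orthonormal_on I v" "k \<notin> I" "norm u = 1" "\<And>i. i \<in> I \<Longrightarrow> v i \<bullet> u = 0"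
  shows "orthonormal_on (insert k I) (v(k := u))"
proof -
  have "u \<bullet> v i = 0" if "i \<in> I" for i
    using assms(4)[OF that] by (simp add: inner_commute)
  moreover have "u \<bullet> u = 1"
    using assms(3) by (simp add: norm_eq_1)
  ultimately show ?thesis
    using assms(1,2,4) unfolding orthonormal_on_def Ball_def fun_upd_apply insert_iff by metis
qed

lemma orthonormal_extend:
  fixes v :: "'n::finite \<Rightarrow> real ^ 'n"
  assumes "orthonormal_on I v"
  shows "\<exists>w. orthonormal_on UNIV w \<and> (\<forall>i\<in>I. w i = v i)"
proof -
  have "\<exists>w. orthonormal_on (I \<union> J) w \<and> (\<forall>i\<in>I. w i = v i)" if "finite J" for J
    using that
  proof (induction J)
    case empty
    thus ?case using assms by auto
  next
    case (insert k J)
    then obtain w where w: "orthonormal_on (I \<union> J) w" "\<forall>i\<in>I. w i = v i"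
      by blast
    show ?case
    proof (cases "k \<in> I")
      case True
      thus ?thesis using w by (auto simp: insert_absorb)
    next
      case False
      hence k: "k \<notin> I \<union> J" using insert by simp
      then obtain u where "norm u = 1" "\<And>i. i \<in> I \<union> J \<Longrightarrow> w i \<bullet> u = 0"
        using exists_unit_orthogonal_to_family[of "I \<union> J" w] by blast
      hence "orthonormal_on (insert k (I \<union> J)) (w(k := u))"
        using w k by (intro orthonormal_on_insert)
      thus ?thesis
        using w(2) False by (intro exI[of _ "w(k := u)"]) (auto simp del: fun_upd_apply, auto)
    qed
  qed
  from this[of UNIV] show ?thesis by simp
qed

text \<open>
  Spectral theorem. The orthogonal complement of a family of eigenvectors of a symmetric matrix is
  invariant, so it contains a further eigenvector until the family is complete.
\<close>

lemma symmetric_orthonormal_eigenbasis: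
  fixes A :: "real ^ 'n::finite ^ 'n"
  assumes sym: "transpose A = A"
  obtains v :: "'n \<Rightarrow> real ^ 'n" and c where "orthonormal_on UNIV v" "\<And>i. A *v v i = c i *\<^sub>R v i"
proof -
  have adj: "x \<bullet> (A *v y) = (A *v x) \<bullet> y" for x y
    by (metis dot_lmul_matrix inner_commute sym transpose_matrix_vector)
  have "\<exists>v c. orthonormal_on I v \<and> (\<forall>i\<in>I. A *v v i = c i *\<^sub>R v i)" if "finite I" for I :: "'n set"
    using that
  proof (induction I)
    case empty
    thus ?case by (auto simp: orthonormal_on_def)
  next
    case (insert k I)
    then obtain v c where v: "orthonormal_on I v" "\<And>i. i \<in> I \<Longrightarrow> A *v v i = c i *\<^sub>R v i"
      by blast
    define S where "S = {x. \<forall>i\<in>I. v i \<bullet> x = 0}"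
    have sub: "subspace S"
      by (auto simp: S_def subspace_def inner_add_right)
    have inv: "A *v x \<in> S" if "x \<in> S" for x
    proof -
      have "v i \<bullet> (A *v x) = 0" if "i \<in> I" for i
        using \<open>x \<in> S\<close> that v(2)[OF that] adj[of "v i" x] by (simp add: S_def)
      thus ?thesis by (simp add: S_def)
    qed
    have "I \<noteq> UNIV"
      using insert by auto
    then obtain u0 where u0: "norm u0 = 1" "\<And>i. i \<in> I \<Longrightarrow> v i \<bullet> u0 = 0"
      using exists_unit_orthogonal_to_family[of I v] by blast
    have "u0 \<in> S"
      using u0(2) by (simp add: S_def)
    obtain u d where u: "u \<in> S" "norm u = 1" "A *v u = d *\<^sub>R u"
      using symmetric_eigenvector_in_invariant_subspace[OF sym sub inv \<open>u0 \<in> S\<close> u0(1)] by blast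
    have "orthonormal_on (insert k I) (v(k := u))"
      using u by (intro orthonormal_on_insert[OF v(1) insert(2)]) (auto simp: S_def)
    moreover have "\<forall>i\<in>insert k I. A *v (v(k := u)) i = (c(k := d)) i *\<^sub>R (v(k := u)) i"
      using v u insert by auto
    ultimately show ?case by blast
  qed
  from this[of UNIV] obtain v :: "'n \<Rightarrow> real ^ 'n" and c where "orthonormal_on UNIV v" "\<forall>i. A *v v i = c i *\<^sub>R v i"
    by auto
  thus thesis
    using that by blast
qed

lemma orthogonal_matrix_of_columns:
  fixes v :: "'n::finite \<Rightarrow> real ^ 'n"
  assumes "orthonormal_on UNIV v"
  shows "orthogonal_matrix (\<chi> i j. v j $ i)"
  using assms
  by (simp add: orthonormal_on_def orthogonal_matrix vec_eq_iff matrix_matrix_mult_def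
      transpose_def mat_def inner_vec_def)

text \<open>
  If the \<open>v\<^sub>i\<close> are an orthonormal eigenbasis of \<open>X\<^sup>T X\<close>, the vectors \<open>X v\<^sub>i\<close> are pairwise orthogonal.
  Normalising those that are nonzero and completing them to an orthonormal basis yields the left
  singular vectors.
\<close>

theorem singular_value_decomposition:
  fixes X :: "real ^ 'n::finite ^ 'n"
  obtains U V :: "real ^ 'n ^ 'n" and d :: "real ^ 'n"
  where "orthogonal_matrix U" "orthogonal_matrix V" "\<And>i. 0 \<le> d $ i"
    "X = U ** (\<chi> i j. if i = j then d $ i else 0) ** transpose V"
proof -
  obtain v :: "'n \<Rightarrow> real ^ 'n" and c where v: "orthonormal_on UNIV v" "\<And>i. (transpose X ** X) *v v i = c i *\<^sub>R v i"
    using symmetric_orthonormal_eigenbasis[of "transpose X ** X"]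
    by (auto simp: matrix_transpose_mul)
  define d where "d = (\<chi> i. norm (X *v v i))"
  have Xv: "(X *v v i) \<bullet> (X *v v j) = (if i = j then c i else 0)" for i j
  proof -
    have "(X *v v i) \<bullet> (X *v v j) = ((transpose X ** X) *v v i) \<bullet> v j"
      by (metis dot_lmul_matrix matrix_vector_mul_assoc transpose_matrix_vector)
    thus ?thesis
      using v by (simp add: orthonormal_on_def)
  qed
  have cd: "c i = (d $ i)\<^sup>2" for i
    using Xv[of i i] by (simp add: d_def power2_norm_eq_inner)
  define I where "I = {i. d $ i \<noteq> 0}"
  have "orthonormal_on I (\<lambda>i. (X *v v i) /\<^sub>R d $ i)"
    unfolding orthonormal_on_def by (auto simp: Xv cd I_def power2_eq_square field_simps)
  then obtain u where u: "orthonormal_on UNIV u" "\<forall>i\<in>I. u i = (X *v v i) /\<^sub>R d $ i"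
    using orthonormal_extend by blast
  have Xu: "X *v v i = d $ i *\<^sub>R u i" for i
    using u(2) by (cases "i \<in> I") (auto simp: I_def d_def)
  define U :: "real ^ 'n ^ 'n" where "U = (\<chi> i j. u j $ i)"
  define V :: "real ^ 'n ^ 'n" where "V = (\<chi> i j. v j $ i)"
  have "X ** V = U ** (\<chi> i j. if i = j then d $ i else 0)"
    using Xu
    by (simp add: U_def V_def vec_eq_iff matrix_matrix_mult_def matrix_vector_mult_def
        if_distrib[of "\<lambda>x. _ * x"] sum.delta mult.commute cong: if_cong)
  hence "X ** (V ** transpose V) = U ** (\<chi> i j. if i = j then d $ i else 0) ** transpose V"
    by (simp add: matrix_mul_assoc)
  moreover have V: "orthogonal_matrix V"
    unfolding V_def using v(1) by (rule orthogonal_matrix_of_columns)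
  ultimately have "X = U ** (\<chi> i j. if i = j then d $ i else 0) ** transpose V"
    by (simp add: orthogonal_matrix_def)
  moreover have "orthogonal_matrix U"
    unfolding U_def using u(1) by (rule orthogonal_matrix_of_columns)
  moreover have "0 \<le> d $ i" for i
    by (simp add: d_def)
  ultimately show thesis
    using V that by blast
qed

section \<open>Frobenius norm and orthogonal matrices\<close>

lemma norm_matrix_sq_rows: "(norm A)\<^sup>2 = (\<Sum>i\<in>UNIV. (norm (A $ i))\<^sup>2)"
  for A :: "real ^ 'c ^ 'r"
  by (simp add: norm_vec_def[of A] L2_set_def sum_nonneg)

lemma norm_vec_sq: "(norm x)\<^sup>2 = (\<Sum>k\<in>UNIV. (x $ k)\<^sup>2)" for x :: "real ^ 'n"
  by (simp add: norm_vec_def L2_set_def sum_nonneg)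

lemma norm_matrix_mono:
  fixes A B :: "real ^ 'c ^ 'r"
  assumes "\<And>i j. \<bar>A $ i $ j\<bar> \<le> \<bar>B $ i $ j\<bar>"
  shows "norm A \<le> norm B"
  unfolding norm_matrix_eq_frobenius
  by (intro real_sqrt_le_mono sum_mono) (use assms in \<open>simp add: abs_le_square_iff\<close>)

lemma norm_transpose: "norm (transpose A) = norm A" for A :: "real ^ 'c ^ 'r"
  unfolding norm_matrix_eq_frobenius transpose_def by (subst sum.swap) simp

lemma norm_matrix_vector_mult_le: "norm (A *v x) \<le> norm A * norm x"
  for A :: "real ^ 'c ^ 'r"
proof -
  have "norm (A *v x) \<le> norm (\<chi> i. norm (A $ i) * norm x)"
    by (rule norm_le_componentwise_cart)
       (simp add: matrix_mult_dot Cauchy_Schwarz_ineq2)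
  also have "(\<chi> i. norm (A $ i) * norm x) = norm x *\<^sub>R (\<chi> i. norm (A $ i))"
    by (simp add: vec_eq_iff)
  also have "norm \<dots> = norm A * norm x"
    by (simp add: norm_vec_def[of A] norm_vec_def[of "\<chi> i. norm (A $ i)"])
  finally show ?thesis .
qed

lemma norm_sum_rows_le:
  fixes A :: "real ^ 'c ^ 'r"
  shows "norm (\<Sum>j\<in>J. A $ j) \<le> sqrt (real CARD('r)) * sqrt (\<Sum>j\<in>J. (norm (A $ j))\<^sup>2)"
proof -
  have "norm (\<Sum>j\<in>J. A $ j) \<le> (\<Sum>j\<in>J. \<bar>1\<bar> * \<bar>norm (A $ j)\<bar>)"
    using norm_sum[of "\<lambda>j. A $ j" J] by simp
  also have "\<dots> \<le> L2_set (\<lambda>_. 1) J * L2_set (\<lambda>j. norm (A $ j)) J"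
    by (rule L2_set_mult_ineq)
  also have "\<dots> \<le> sqrt (real CARD('r)) * L2_set (\<lambda>j. norm (A $ j)) J"
    by (intro mult_right_mono) (simp_all add: L2_set_constant card_mono)
  finally show ?thesis
    by (simp add: L2_set_def)
qed

lemma norm_orthogonal_matrix_mult_vec:
  fixes Q :: "real ^ 'n ^ 'n"
  assumes "orthogonal_matrix Q"
  shows "norm (Q *v x) = norm x"
proof -
  have "(Q *v x) \<bullet> (Q *v x) = ((transpose Q ** Q) *v x) \<bullet> x"
    by (metis dot_lmul_matrix matrix_vector_mul_assoc transpose_matrix_vector)
  thus ?thesis
    using assms by (simp add: norm_eq orthogonal_matrix)
qed

lemma norm_mult_orthogonal_right:
  fixes A :: "real ^ 'n ^ 'm" and V :: "real ^ 'n ^ 'n"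
  assumes "orthogonal_matrix V"
  shows "norm (A ** V) = norm A"
proof -
  have "(A ** V) $ i = transpose V *v (A $ i)" for i
    by (simp add: vec_eq_iff matrix_matrix_mult_def matrix_vector_mult_def transpose_def mult.commute)
  hence "norm ((A ** V) $ i) = norm (A $ i)" for i
    using norm_orthogonal_matrix_mult_vec[of "transpose V" "A $ i"] assms by simp
  thus ?thesis
    by (simp add: norm_vec_def[of "A ** V"] norm_vec_def[of A])
qed

lemma norm_mult_orthogonal_left:
  fixes A :: "real ^ 'm ^ 'n" and U :: "real ^ 'n ^ 'n"
  assumes "orthogonal_matrix U"
  shows "norm (U ** A) = norm A"
proof -
  have "norm (U ** A) = norm (transpose A ** transpose U)"
    by (metis matrix_transpose_mul norm_transpose)
  thus ?thesis
    using assms by (simp add: norm_mult_orthogonal_right norm_transpose)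
qed

lemma orthogonal_matrix_rows:
  "orthogonal_matrix Q \<longleftrightarrow> (\<forall>i j. Q $ i \<bullet> Q $ j = (if i = j then 1 else 0))"
  for Q :: "real ^ 'n ^ 'n"
proof -
  have "orthogonal_matrix Q \<longleftrightarrow> Q ** transpose Q = mat 1"
    by (metis orthogonal_matrix_def matrix_left_right_inverse)
  thus ?thesis
    by (simp add: vec_eq_iff matrix_matrix_mult_def transpose_def mat_def inner_vec_def)
qed

lemma orthogonal_matrix_column_sum:
  fixes Q :: "real ^ 'n ^ 'n"
  assumes "orthogonal_matrix Q"
  shows "(\<Sum>i\<in>UNIV. (Q $ i $ k)\<^sup>2) = 1"
proof -
  have "(transpose Q ** Q) $ k $ k = 1"
    using assms by (simp add: orthogonal_matrix mat_def)
  thus ?thesis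
    by (simp add: matrix_matrix_mult_def transpose_def power2_eq_square)
qed

lemma norm_orthogonal_matrix:
  fixes Q :: "real ^ 'n ^ 'n"
  assumes "orthogonal_matrix Q"
  shows "norm Q = sqrt (real CARD('n))"
proof -
  have "(norm Q)\<^sup>2 = real CARD('n)"
    using assms by (simp add: norm_matrix_sq_rows orthogonal_matrix_rows power2_norm_eq_inner)
  thus ?thesis
    by (metis norm_ge_zero real_sqrt_unique)
qed

section \<open>An orthogonal matrix at distance given by the singular values\<close>

lemma bij_betw_card_less:
  "bij_betw (\<lambda>i::'n::{finite, linorder}. card {j. j < i}) UNIV {..<CARD('n::{finite, linorder})}"
proof -
  have "strict_mono (\<lambda>i::'n. card {j. j < i})"
    by (intro strict_monoI psubset_card_mono) (auto intro: less_trans)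
  hence inj: "inj (\<lambda>i::'n. card {j. j < i})"
    by (rule strict_mono_imp_inj_on)
  moreover have "range (\<lambda>i::'n. card {j. j < i}) \<subseteq> {..<CARD('n)}"
    by (auto intro!: psubset_card_mono)
  hence "range (\<lambda>i::'n. card {j. j < i}) = {..<CARD('n)}"
    by (intro card_subset_eq) (simp_all add: card_image inj)
  ultimately show ?thesis
    by (simp add: bij_betw_def)
qed

text \<open>
  The order in which the singular values are listed does not matter for symmetric expressions, such as
  the norm of the vector of singular values.
\<close>

lemma sum_singular_values:
  fixes X :: "real ^ 'n::{finite, linorder} ^ 'n::{finite, linorder}" and g :: "real \<Rightarrow> real"
  assumes "size (singular_value_mset X) = CARD('n)"
  shows "(\<Sum>i\<in>UNIV. g (singular_values X $ i)) = (\<Sum>x\<in>#singular_value_mset X. g x)"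
proof -
  define xs where "xs = rev (sorted_list_of_multiset (singular_value_mset X))"
  have mset: "mset xs = singular_value_mset X"
    by (simp add: xs_def)
  have len: "length xs = CARD('n)"
    using assms mset by (metis size_mset)
  have "(\<Sum>i\<in>UNIV. g (singular_values X $ i)) = (\<Sum>i\<in>UNIV. g (xs ! card {j::'n. j < i}))"
    by (simp add: singular_values_def xs_def)
  also have "\<dots> = (\<Sum>k<CARD('n). g (xs ! k))"
    by (rule sum.reindex_bij_betw[OF bij_betw_card_less, of "\<lambda>k. g (xs ! k)"])
  also have "\<dots> = sum_list (map g xs)"
    by (simp add: sum_list_sum_nth len atLeast0LessThan)
  also have "\<dots> = (\<Sum>x\<in>#singular_value_mset X. g x)"
    by (simp flip: mset sum_mset_sum_list)
  finally show ?thesis .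
qed

text \<open>
  If \<open>X = U D V\<^sup>T\<close>, the matrix in question is \<open>U V\<^sup>T\<close>: multiplication by orthogonal matrices does not
  change the norm of \<open>D - I\<close>, whose diagonal entries are the singular values minus 1.
\<close>

lemma orthogonal_matrix_at_singular_value_distance:
  fixes X :: "real ^ 'n::{finite, linorder} ^ 'n::{finite, linorder}"
  obtains Q where "orthogonal_matrix Q" "norm (X - Q) = norm (singular_values X - 1)"
proof -
  obtain U V and d :: "(real, 'n) vec"
    where U: "orthogonal_matrix U" and V: "orthogonal_matrix V" and d: "\<And>i. 0 \<le> d $ i"
      and X: "X = U ** (\<chi> i j. if i = j then d $ i else 0) ** transpose V"
    using singular_value_decomposition[of X] by blast
  define D where "D = (\<chi> i j. if i = j then d $ i else 0)"
  have mset: "singular_value_mset X = image_mset (($) d) (mset_set UNIV)"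
    using U V d X by (rule singular_value_mset_svd)
  have "(norm (singular_values X - 1))\<^sup>2 = (\<Sum>i\<in>UNIV. (singular_values X $ i - 1)\<^sup>2)"
    by (simp add: norm_vec_sq)
  also have "\<dots> = (\<Sum>x\<in>#singular_value_mset X. (x - 1)\<^sup>2)"
    by (rule sum_singular_values) (simp add: mset)
  also have "\<dots> = (\<Sum>i\<in>UNIV. (d $ i - 1)\<^sup>2)"
    by (simp add: mset multiset.map_comp o_def sum_unfold_sum_mset)
  also have "\<dots> = (\<Sum>i\<in>UNIV. \<Sum>j\<in>UNIV. if i = j then (d $ i - 1)\<^sup>2 else 0)"
    by simp
  also have "\<dots> = (norm (D - mat 1))\<^sup>2"
    unfolding norm_matrix_sq_rows norm_vec_sq by (intro sum.cong refl) (simp add: D_def mat_def)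
  finally have "norm (singular_values X - 1) = norm (D - mat 1)"
    by simp
  also have "\<dots> = norm (U ** (D - mat 1) ** transpose V)"
    using U V by (simp add: norm_mult_orthogonal_left norm_mult_orthogonal_right)
  also have "U ** (D - mat 1) ** transpose V = X - U ** transpose V"
  proof -
    have "U ** D = U ** (D - mat 1) + U"
      using matrix_add_ldistrib[of U "D - mat 1" "mat 1"] by simp
    hence "X = U ** (D - mat 1) ** transpose V + U ** transpose V"
      by (simp add: X D_def[symmetric] vec_eq_iff matrix_matrix_mult_def[of _ "transpose V"]
          distrib_right sum.distrib)
    thus ?thesis by simp
  qed
  finally have "norm (X - U ** transpose V) = norm (singular_values X - 1)"
    by simp
  moreover have "orthogonal_matrix (U ** transpose V)"
    using U V by (simp add: orthogonal_matrix_mul)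
  ultimately show thesis
    using that by blast
qed

section \<open>Unit vectors concentrated on one coordinate\<close>

text \<open>
  The sum vanishes exactly at the vectors \<open>\<plusminus> axis m 1\<close>; this is the quantitative version. If all squared entries
  were at most 1/2, each summand would be at least \<open>(q $ k)\<^sup>2\<close> and the sum at least 1. So some entry \<open>q $ m\<close>, of absolute value \<open>c\<close>,
  dominates. The other entries form a vector of norm \<open>r = \<surd>(1 - c\<^sup>2)\<close>; the dominant entry and
  the remaining ones each contribute at least \<open>c r\<close> to the sum, and \<open>2 c r \<ge> \<surd>2 r\<close>. Finally \<open>2 - 2 \<bar>q $ m\<bar>\<close> is the
  squared distance from \<open>q\<close> to the nearest of \<open>\<plusminus> axis m 1\<close>.
\<close>

lemma unit_vector_near_axis:
  fixes q :: "real ^ 'n"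
  assumes q: "norm q = 1" and F: "(\<Sum>k\<in>UNIV. \<bar>q $ k\<bar> * sqrt (1 - (q $ k)\<^sup>2)) \<le> F" and "F < 1"
  obtains m where "(q $ m)\<^sup>2 > 1 / 2" "2 - 2 * \<bar>q $ m\<bar> \<le> F\<^sup>2"
proof -
  have one: "(\<Sum>k\<in>UNIV. (q $ k)\<^sup>2) = 1"
    using q by (simp flip: norm_vec_sq)
  have le1: "(q $ k)\<^sup>2 \<le> 1" for k
    unfolding one[symmetric] by (rule member_le_sum) auto
  have "\<exists>m. (q $ m)\<^sup>2 > 1 / 2"
  proof (rule ccontr)
    assume "\<nexists>m. (q $ m)\<^sup>2 > 1 / 2"
    hence small: "(q $ k)\<^sup>2 \<le> 1 / 2" for k
      by (simp add: not_less)
    have "(q $ k)\<^sup>2 \<le> \<bar>q $ k\<bar> * sqrt (1 - (q $ k)\<^sup>2)" for k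
    proof -
      have "\<bar>q $ k\<bar> \<le> sqrt (1 - (q $ k)\<^sup>2)"
        using small[of k] by (intro real_le_rsqrt) simp
      hence "\<bar>q $ k\<bar> * \<bar>q $ k\<bar> \<le> \<bar>q $ k\<bar> * sqrt (1 - (q $ k)\<^sup>2)"
        by (rule mult_left_mono) simp
      thus ?thesis by (simp add: power2_eq_square)
    qed
    hence "1 \<le> (\<Sum>k\<in>UNIV. \<bar>q $ k\<bar> * sqrt (1 - (q $ k)\<^sup>2))"
      unfolding one[symmetric] by (rule sum_mono)
    with F \<open>F < 1\<close> show False by simp
  qed
  then obtain m where m: "(q $ m)\<^sup>2 > 1 / 2" by blast
  define c where "c = \<bar>q $ m\<bar>"
  define r where "r = sqrt (1 - c\<^sup>2)"
  have c2: "c\<^sup>2 > 1 / 2" "c\<^sup>2 \<le> 1" "0 \<le> c"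
    using m le1[of m] by (simp_all add: c_def)
  have c1: "c \<le> 1"
    using c2 by (metis abs_le_square_iff abs_of_nonneg one_power2 abs_one)
  have rest: "(\<Sum>k\<in>UNIV - {m}. (q $ k)\<^sup>2) = 1 - c\<^sup>2"
    using one sum.remove[of UNIV m "\<lambda>k. (q $ k)\<^sup>2"] by (simp add: c_def)
  have "r = L2_set (($) q) (UNIV - {m})"
    by (simp add: r_def L2_set_def rest)
  also have "\<dots> \<le> (\<Sum>k\<in>UNIV - {m}. \<bar>q $ k\<bar>)"
    by (rule L2_set_le_sum_abs)
  finally have r_le: "r \<le> (\<Sum>k\<in>UNIV - {m}. \<bar>q $ k\<bar>)" .
  have c_le: "c \<le> sqrt (1 - (q $ k)\<^sup>2)" if "k \<in> UNIV - {m}" for k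
  proof (rule real_le_rsqrt)
    have "(q $ k)\<^sup>2 \<le> 1 - c\<^sup>2"
      unfolding rest[symmetric] using that by (intro member_le_sum) auto
    thus "c\<^sup>2 \<le> 1 - (q $ k)\<^sup>2" by simp
  qed
  have "2 * c * r = c * r + r * c" by simp
  also have "\<dots> \<le> c * r + (\<Sum>k\<in>UNIV - {m}. \<bar>q $ k\<bar>) * c"
    using r_le c2 by (intro add_left_mono mult_right_mono)
  also have "\<dots> \<le> c * r + (\<Sum>k\<in>UNIV - {m}. \<bar>q $ k\<bar> * sqrt (1 - (q $ k)\<^sup>2))"
    unfolding sum_distrib_right using c_le by (intro add_left_mono sum_mono mult_left_mono) auto
  also have "\<dots> = (\<Sum>k\<in>UNIV. \<bar>q $ k\<bar> * sqrt (1 - (q $ k)\<^sup>2))"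
    using sum.remove[of UNIV m "\<lambda>k. \<bar>q $ k\<bar> * sqrt (1 - (q $ k)\<^sup>2)"] by (simp add: c_def r_def)
  also have "\<dots> \<le> F" by (rule F)
  finally have "(2 * c * r)\<^sup>2 \<le> F\<^sup>2"
    using c2 by (intro power_mono) (auto simp: r_def)
  moreover have "(2 * c * r)\<^sup>2 = 4 * c\<^sup>2 * (1 - c\<^sup>2)"
    using c2 by (simp add: r_def power_mult_distrib)
  moreover have "4 * c\<^sup>2 * (1 - c\<^sup>2) \<ge> 2 * (1 - c\<^sup>2)"
    using c2 by (intro mult_right_mono) auto
  moreover have "1 - c\<^sup>2 \<ge> 1 - c"
    using c1 c2(3) by (simp add: power2_eq_square mult_left_le)
  ultimately have "2 - 2 * c \<le> F\<^sup>2" by simp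
  with m show thesis by (intro that[of m]) (simp_all add: c_def)
qed

section \<open>Overlap of the rows of an orthogonal matrix\<close>

text \<open>
  The entries of column \<open>k\<close> outside row \<open>i\<close> have Euclidean norm \<open>\<surd>(1 - (Q $ i $ k)\<^sup>2)\<close>, which is at most
  their absolute sum.
\<close>

lemma overlap_le_sum_rows:
  fixes Q :: "real ^ 'n ^ 'n"
  assumes "orthogonal_matrix Q"
  shows "(\<Sum>k\<in>UNIV. \<bar>Q $ i $ k\<bar> * sqrt (1 - (Q $ i $ k)\<^sup>2))
    \<le> (\<Sum>k\<in>UNIV. \<bar>Q $ i $ k\<bar> * (\<Sum>j\<in>UNIV - {i}. \<bar>Q $ j $ k\<bar>))"
proof (intro sum_mono mult_left_mono)
  fix k
  have "(\<Sum>j\<in>UNIV - {i}. (Q $ j $ k)\<^sup>2) = 1 - (Q $ i $ k)\<^sup>2"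
    using orthogonal_matrix_column_sum[OF assms, of k] sum.remove[of UNIV i "\<lambda>j. (Q $ j $ k)\<^sup>2"]
    by simp
  hence "sqrt (1 - (Q $ i $ k)\<^sup>2) = L2_set (\<lambda>j. Q $ j $ k) (UNIV - {i})"
    by (simp add: L2_set_def)
  also have "\<dots> \<le> (\<Sum>j\<in>UNIV - {i}. \<bar>Q $ j $ k\<bar>)"
    by (rule L2_set_le_sum_abs)
  finally show "sqrt (1 - (Q $ i $ k)\<^sup>2) \<le> (\<Sum>j\<in>UNIV - {i}. \<bar>Q $ j $ k\<bar>)" .
qed simp

text \<open>
  Subtract \<open>\<langle>Y\<^sub>i - Z\<^sub>i, Y\<^sub>j - Z\<^sub>j\<rangle> = 0\<close> from \<open>\<langle>Y\<^sub>i + Z\<^sub>i, Y\<^sub>j + Z\<^sub>j\<rangle>\<close>: only the mixed products remain, each of which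
  contains a factor from the negative part.
  The sum over \<open>Y\<close> may include \<open>j = i\<close>, since \<open>Y $ i\<close> and \<open>Z $ i\<close> have disjoint supports. The
  sum over \<open>Z\<close> leaves it out, because the estimate of a single row needs the sharper form.
\<close>

lemma sum_rows_overlap_eq:
  fixes Q :: "real ^ 'n ^ 'n"
  assumes Q: "orthogonal_matrix Q"
  defines "Z \<equiv> matrix_neg_part Q"
  defines "Y \<equiv> Q + Z"
  shows "(\<Sum>k\<in>UNIV. \<bar>Q $ i $ k\<bar> * (\<Sum>j\<in>UNIV - {i}. \<bar>Q $ j $ k\<bar>))
    = 2 * (Y $ i \<bullet> (\<Sum>j\<in>UNIV - {i}. Z $ j) + Z $ i \<bullet> (\<Sum>j\<in>UNIV. Y $ j))"
proof -
  define a where "a = (\<lambda>i. \<chi> k. \<bar>Q $ i $ k\<bar>)"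
  have a: "a j = Y $ j + Z $ j" for j
    by (auto simp: a_def Y_def Z_def matrix_neg_part_def vec_eq_iff)
  have q: "Q $ j = Y $ j - Z $ j" for j
    by (simp add: Y_def)
  have disj: "Z $ i \<bullet> Y $ i = 0"
    by (auto simp: Y_def Z_def matrix_neg_part_def inner_vec_def max_def intro!: sum.neutral)
  have pair: "a i \<bullet> a j = 2 * (Y $ i \<bullet> Z $ j + Z $ i \<bullet> Y $ j)" if "j \<noteq> i" for j
  proof -
    have "Q $ i \<bullet> Q $ j = 0"
      using Q that by (simp add: orthogonal_matrix_rows)
    thus ?thesis
      by (simp add: a q inner_add_left inner_add_right inner_diff_left inner_diff_right)
  qed
  have "(\<Sum>k\<in>UNIV. \<bar>Q $ i $ k\<bar> * (\<Sum>j\<in>UNIV - {i}. \<bar>Q $ j $ k\<bar>)) = (\<Sum>j\<in>UNIV - {i}. a i \<bullet> a j)"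
    unfolding a_def inner_vec_def sum_distrib_left by (subst sum.swap) simp
  also have "\<dots> = (\<Sum>j\<in>UNIV - {i}. 2 * (Y $ i \<bullet> Z $ j + Z $ i \<bullet> Y $ j))"
    by (intro sum.cong refl pair) auto
  also have "\<dots> = 2 * (Y $ i \<bullet> (\<Sum>j\<in>UNIV - {i}. Z $ j) + Z $ i \<bullet> (\<Sum>j\<in>UNIV - {i}. Y $ j))"
    by (simp add: inner_sum_right sum.distrib flip: sum_distrib_left)
  also have "Z $ i \<bullet> (\<Sum>j\<in>UNIV - {i}. Y $ j) = Z $ i \<bullet> (\<Sum>j\<in>UNIV. Y $ j)"
    using disj sum.remove[of UNIV i "\<lambda>j. Y $ j"] by (simp add: inner_add_right)
  finally show ?thesis .
qed

lemma power2_add_le: "(a + b)\<^sup>2 \<le> 2 * (a\<^sup>2 + b\<^sup>2)" for a b :: real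
  using sum_squares_bound[of a b] by (simp add: power2_sum)

text \<open>
  The vector \<open>F\<close> collects the overlaps of all rows. Two different estimates of it are needed. For a
  single entry, row \<open>i\<close> of the negative part (of norm \<open>a\<close>) is separated from the other rows (of total norm
  \<open>b\<close>): from \<open>a\<^sup>2 + b\<^sup>2 = e\<^sup>2\<close> one gets \<open>a + b \<le> \<surd>2 e \<le> 3/2 e\<close> instead of \<open>2 e\<close>, and this gain is what brings \<open>F\<^sub>i\<close>
  below the threshold 1. For the norm of \<open>F\<close>, adding up such estimates would lose another factor \<open>\<surd>n\<close>, whereas
  the matrix form \<open>F = 2 (Y w + Z v)\<close> does not.
\<close>

lemma row_overlap_bounds:
  fixes Q :: "real ^ 'n ^ 'n"
  assumes Q: "orthogonal_matrix Q" and small: "norm (matrix_neg_part Q) < 1 / (4 * sqrt (real CARD('n)))"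
  obtains F :: "real ^ 'n"
  where "\<And>i. (\<Sum>k\<in>UNIV. \<bar>Q $ i $ k\<bar> * sqrt (1 - (Q $ i $ k)\<^sup>2)) \<le> F $ i"
    and "\<And>i. F $ i < 1"
    and "norm F \<le> 5 * sqrt (real CARD('n)) * norm (matrix_neg_part Q)"
proof -
  define Z where "Z = matrix_neg_part Q"
  define Y where "Y = Q + Z"
  define w where "w = (\<Sum>j\<in>UNIV. Z $ j)"
  define v where "v = (\<Sum>j\<in>UNIV. Y $ j)"
  define n where "n = real CARD('n)"
  define e where "e = norm Z"
  define F where "F = 2 *\<^sub>R (Y *v w + Z *v v)"
  have n: "sqrt n \<ge> 1"
    by (simp add: n_def)
  have e0: "0 \<le> e"
    by (simp add: e_def)
  have ne: "sqrt n * e < 1 / 4"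
    using small n unfolding e_def Z_def n_def[symmetric] by (simp add: field_simps)
  have e: "e \<le> 1 / 4"
    using mult_right_mono[OF n e0] ne by simp
  have w: "norm w \<le> sqrt n * e"
    using norm_sum_rows_le[of Z UNIV] by (simp add: w_def n_def e_def flip: norm_matrix_sq_rows)
  have "(\<Sum>j\<in>UNIV. Q $ j) = transpose Q *v 1"
    by (simp add: vec_eq_iff matrix_vector_mult_def transpose_def del: vector_transpose_matrix transpose_matrix_vector)
  moreover have "norm (transpose Q *v 1) = norm (1 :: real ^ 'n)"
    using Q by (intro norm_orthogonal_matrix_mult_vec) simp
  moreover have "norm (1 :: real ^ 'n) = sqrt n"
    by (simp add: norm_vec_def L2_set_def n_def)
  moreover have "v = (\<Sum>j\<in>UNIV. Q $ j) + w"
    by (simp add: v_def w_def Y_def sum.distrib)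
  ultimately have v: "norm v \<le> sqrt n * (1 + e)"
    using w norm_triangle_ineq[of "\<Sum>j\<in>UNIV. Q $ j" w] by (simp add: algebra_simps)
  have eq: "(\<Sum>k\<in>UNIV. \<bar>Q $ i $ k\<bar> * (\<Sum>j\<in>UNIV - {i}. \<bar>Q $ j $ k\<bar>))
      = 2 * (Y $ i \<bullet> (\<Sum>j\<in>UNIV - {i}. Z $ j) + Z $ i \<bullet> v)" for i
    unfolding v_def Y_def Z_def by (rule sum_rows_overlap_eq[OF Q])
  have F: "F $ i = 2 * (Y $ i \<bullet> (\<Sum>j\<in>UNIV - {i}. Z $ j) + Z $ i \<bullet> v)" for i
  proof -
    have "Y $ i \<bullet> Z $ i = 0"
      by (auto simp: Y_def Z_def matrix_neg_part_def inner_vec_def max_def intro!: sum.neutral)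
    hence "Y $ i \<bullet> w = Y $ i \<bullet> (\<Sum>j\<in>UNIV - {i}. Z $ j)"
      using sum.remove[of UNIV i "\<lambda>j. Z $ j"] by (simp add: w_def inner_add_right)
    thus ?thesis
      by (simp add: F_def matrix_mult_dot)
  qed
  show thesis
  proof
    show "(\<Sum>k\<in>UNIV. \<bar>Q $ i $ k\<bar> * sqrt (1 - (Q $ i $ k)\<^sup>2)) \<le> F $ i" for i
      using overlap_le_sum_rows[OF Q, of i] by (simp add: F eq)
    show "F $ i < 1" for i
    proof -
      define a where "a = norm (Z $ i)"
      define b where "b = sqrt (\<Sum>j\<in>UNIV - {i}. (norm (Z $ j))\<^sup>2)"
      have a0: "0 \<le> a" and b0: "0 \<le> b"
        by (simp_all add: a_def b_def sum_nonneg)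
      have ab: "a\<^sup>2 + b\<^sup>2 = e\<^sup>2"
        using sum.remove[of UNIV i "\<lambda>j. (norm (Z $ j))\<^sup>2"]
        by (simp add: a_def b_def e_def norm_matrix_sq_rows[of Z] sum_nonneg)
      have "(a + b)\<^sup>2 \<le> 2 * (a\<^sup>2 + b\<^sup>2)"
        by (rule power2_add_le)
      also have "\<dots> \<le> (3 / 2 * e)\<^sup>2"
        unfolding ab power_mult_distrib by (intro mult_right_mono) (simp_all add: power2_eq_square)
      finally have sum_ab: "a + b \<le> 3 / 2 * e"
        by (rule power2_le_imp_le) (use e0 in simp)
      have "a \<le> e"
      proof (rule power2_le_imp_le[OF _ e0])
        show "a\<^sup>2 \<le> e\<^sup>2" unfolding ab[symmetric] by simp
      qed
      hence ae: "a * (1 + e) \<le> a + e / 4"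
        using mult_mono[of a e e "1 / 4"] e e0 by (simp add: algebra_simps)
      have "norm (Y $ i) \<le> norm (Q $ i)"
        by (rule norm_le_componentwise_cart) (auto simp: Y_def Z_def matrix_neg_part_def)
      hence Yi: "norm (Y $ i) \<le> 1"
        using Q by (simp add: orthogonal_matrix_rows norm_eq_sqrt_inner)
      have "Y $ i \<bullet> (\<Sum>j\<in>UNIV - {i}. Z $ j) \<le> norm (Y $ i) * norm (\<Sum>j\<in>UNIV - {i}. Z $ j)"
        by (rule norm_cauchy_schwarz)
      also have "\<dots> \<le> 1 * (sqrt n * b)"
        using Yi norm_sum_rows_le[of Z "UNIV - {i}"] unfolding n_def b_def
        by (intro mult_mono) auto
      finally have 1: "Y $ i \<bullet> (\<Sum>j\<in>UNIV - {i}. Z $ j) \<le> sqrt n * b" by simp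
      have "Z $ i \<bullet> v \<le> a * norm v"
        unfolding a_def by (rule norm_cauchy_schwarz)
      also have "\<dots> \<le> a * (sqrt n * (1 + e))"
        using v a0 by (intro mult_left_mono)
      finally have "F $ i \<le> 2 * (sqrt n * (b + a * (1 + e)))"
        unfolding F using 1 by (simp add: algebra_simps)
      also have "\<dots> \<le> 2 * (sqrt n * (7 / 4 * e))"
        using sum_ab ae n by (intro mult_left_mono) auto
      also have "\<dots> = 7 / 2 * (sqrt n * e)"
        by simp
      also have "\<dots> < 1"
        using ne by linarith
      finally show ?thesis .
    qed
    have "norm (Y *v w) \<le> norm w + e * norm w"
    proof -
      have "Y *v w = Q *v w + Z *v w"
        by (simp add: Y_def matrix_vector_mult_add_rdistrib)
      thus ?thesis
        using norm_triangle_ineq[of "Q *v w" "Z *v w"] norm_matrix_vector_mult_le[of Z w]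
          norm_orthogonal_matrix_mult_vec[OF Q, of w] by (simp add: e_def)
    qed
    also have "\<dots> \<le> sqrt n * e + 1 / 4 * (sqrt n * e)"
      using w e e0 by (intro add_mono mult_mono) auto
    finally have Yw: "norm (Y *v w) \<le> 5 / 4 * (sqrt n * e)" by linarith
    have "norm (Z *v v) \<le> e * norm v"
      unfolding e_def by (rule norm_matrix_vector_mult_le)
    also have "\<dots> \<le> e * (sqrt n * (5 / 4))"
    proof (rule mult_left_mono[OF _ e0])
      have "sqrt n * (1 + e) \<le> sqrt n * (5 / 4)"
        using e n by (intro mult_left_mono) auto
      with v show "norm v \<le> sqrt n * (5 / 4)" by simp
    qed
    also have "\<dots> = 5 / 4 * (sqrt n * e)"
      by simp
    finally have "norm F \<le> 5 * (sqrt n * e)"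
      using Yw norm_triangle_ineq[of "Y *v w" "Z *v v"] by (simp add: F_def)
    thus "norm F \<le> 5 * sqrt (real CARD('n)) * norm (matrix_neg_part Q)"
      by (simp add: n_def e_def Z_def)
  qed
qed

section \<open>Orthogonal matrices close to a permutation matrix\<close>

lemma orthogonal_matrix_permutation:
  assumes "inj m"
  shows "orthogonal_matrix ((\<chi> i. axis (m i) 1) :: real ^ 'n ^ 'n)"
  using assms by (auto simp: orthogonal_matrix_rows inner_axis_axis inj_eq)

text \<open>
  The permutation sends each row to the column of its dominant entry. A dominant entry is positive,
  since a negative one would make the norm of the negative part larger than 1/4, and no column
  contains two of them, since two squares above 1/2 do not fit into a unit vector.
\<close>

lemma orthogonal_matrix_near_permutation:
  fixes Q :: "real ^ 'n ^ 'n"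
  assumes Q: "orthogonal_matrix Q" and small: "norm (matrix_neg_part Q) < 1 / (4 * sqrt (real CARD('n)))"
  obtains R :: "real ^ 'n ^ 'n" where "orthogonal_matrix R" "0 \<le> R"
    "norm (Q - R) \<le> 5 * sqrt (real CARD('n)) * norm (matrix_neg_part Q)"
proof -
  obtain F :: "real ^ 'n"
    where F: "\<And>i. (\<Sum>k\<in>UNIV. \<bar>Q $ i $ k\<bar> * sqrt (1 - (Q $ i $ k)\<^sup>2)) \<le> F $ i"
      and F1: "\<And>i. F $ i < 1"
      and normF: "norm F \<le> 5 * sqrt (real CARD('n)) * norm (matrix_neg_part Q)"
    using row_overlap_bounds[OF Q small] by blast
  have norm_row: "norm (Q $ i) = 1" for i
    using Q by (simp add: orthogonal_matrix_rows norm_eq_sqrt_inner)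
  have "\<exists>m. (Q $ i $ m)\<^sup>2 > 1 / 2 \<and> 2 - 2 * \<bar>Q $ i $ m\<bar> \<le> (F $ i)\<^sup>2" for i
    using unit_vector_near_axis[OF norm_row F F1] by blast
  then obtain m where m: "\<And>i. (Q $ i $ m i)\<^sup>2 > 1 / 2" "\<And>i. 2 - 2 * \<bar>Q $ i $ m i\<bar> \<le> (F $ i)\<^sup>2"
    by metis
  have "1 / (4 * sqrt (real CARD('n))) \<le> 1 / 4"
    by (intro divide_left_mono) auto
  with small have neg: "norm (matrix_neg_part Q) < 1 / 4"
    by (rule less_le_trans)
  have pos: "0 < Q $ i $ m i" for i
  proof (rule ccontr)
    assume "\<not> 0 < Q $ i $ m i"
    hence "\<bar>Q $ i $ m i\<bar> = \<bar>matrix_neg_part Q $ i $ m i\<bar>"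
      by (simp add: matrix_neg_part_def)
    also have "\<dots> \<le> norm (matrix_neg_part Q)"
      using component_le_norm_cart[of "matrix_neg_part Q $ i" "m i"]
        Finite_Cartesian_Product.norm_nth_le[of "matrix_neg_part Q" i] by simp
    finally have "\<bar>Q $ i $ m i\<bar> \<le> 1 / 4"
      using neg by simp
    hence "(Q $ i $ m i)\<^sup>2 \<le> (1 / 4)\<^sup>2"
      by (simp add: abs_le_square_iff[symmetric])
    with m(1)[of i] show False
      by (simp add: power2_eq_square)
  qed
  have "inj m"
  proof (rule injI, rule ccontr)
    fix i j assume ij: "m i = m j" "i \<noteq> j"
    have "(\<Sum>l\<in>{i, j}. (Q $ l $ m i)\<^sup>2) \<le> (\<Sum>l\<in>UNIV. (Q $ l $ m i)\<^sup>2)"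
      by (rule sum_mono2) auto
    thus False
      using ij m(1)[of i] m(1)[of j] orthogonal_matrix_column_sum[OF Q, of "m i"] by simp
  qed
  define R :: "real ^ 'n ^ 'n" where "R = (\<chi> i. axis (m i) 1)"
  have row: "(norm ((Q - R) $ i))\<^sup>2 \<le> (F $ i)\<^sup>2" for i
  proof -
    have "(norm ((Q - R) $ i))\<^sup>2 = 2 - 2 * Q $ i $ m i"
      using Q by (simp add: R_def power2_norm_eq_inner inner_diff_left inner_diff_right
          orthogonal_matrix_rows inner_axis inner_axis' inner_axis_axis)
    thus ?thesis
      using m(2)[of i] pos[of i] by simp
  qed
  have "(norm (Q - R))\<^sup>2 \<le> (norm F)\<^sup>2"
    unfolding norm_matrix_sq_rows[of "Q - R"] norm_vec_sq[of F] using row by (intro sum_mono)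
  hence "norm (Q - R) \<le> norm F"
    by (rule power2_le_imp_le) simp
  moreover have "orthogonal_matrix R"
    unfolding R_def using \<open>inj m\<close> by (rule orthogonal_matrix_permutation)
  moreover have "0 \<le> R"
    by (simp add: matrix_nonneg_iff R_def axis_def)
  ultimately show thesis
    using normF that by (metis order_trans)
qed

section \<open>The sign pattern\<close>

lemma norm_matrix_neg_part_diff_le:
  "norm (matrix_neg_part A - matrix_neg_part B) \<le> norm (A - B)" for A B :: "real ^ 'c ^ 'r"
  by (rule norm_matrix_mono) (auto simp: matrix_neg_part_def)

lemma sign_matrix_mult_self:
  fixes A :: "real ^ 'c ^ 'r"
  assumes "P \<union> N = UNIV"
  shows "sign_matrix P N * (sign_matrix P N * A) = A"
  using assms by (auto simp: vec_eq_iff sign_matrix_def)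

lemma norm_sign_matrix_mult:
  fixes A :: "real ^ 'c ^ 'r"
  assumes "P \<union> N = UNIV"
  shows "norm (sign_matrix P N * A) = norm A"
proof -
  have "((sign_matrix P N * A) $ i $ j)\<^sup>2 = (A $ i $ j)\<^sup>2" for i j
    using assms by (auto simp: sign_matrix_def)
  thus ?thesis
    unfolding norm_matrix_eq_frobenius by simp
qed

lemma orthogonal_matrix_sign_matrix_mult:
  fixes Q :: "real ^ 'n ^ 'n"
  assumes "P \<union> N = UNIV" and Q: "orthogonal_matrix Q"
  shows "orthogonal_matrix (sign_matrix P N * Q)"
proof -
  have entry: "(sign_matrix P N * Q) $ i $ k * (sign_matrix P N * Q) $ j $ k = Q $ i $ k * Q $ j $ k" for i j k
    using assms(1) by (auto simp: sign_matrix_def)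
  have "(sign_matrix P N * Q) $ i \<bullet> (sign_matrix P N * Q) $ j = Q $ i \<bullet> Q $ j" for i j
    unfolding inner_vec_def inner_real_def entry ..
  with Q show ?thesis
    by (simp add: orthogonal_matrix_rows)
qed

text \<open>
  The two estimates of the theorem, with \<open>\<parallel>X - Q\<parallel>\<close> for an arbitrary orthogonal \<open>Q\<close> in place of
  \<open>\<parallel>\<sigma>(X) - 1\<parallel>\<close>. Since \<open>S * (S * A) = A\<close>, multiplication by \<open>S\<close> turns a nonnegative orthogonal matrix near
  \<open>S * Q\<close> into an element of the manifold equally near to \<open>Q\<close>.
\<close>

lemma infdist_sign_stiefel_le:
  fixes X Q :: "real ^ 'n ^ 'n"
  assumes PN: "P \<union> N = UNIV" and Q: "orthogonal_matrix Q"
  defines "S \<equiv> sign_matrix P N"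
  defines "e \<equiv> norm (matrix_neg_part (S * X)) + norm (X - Q)"
  shows "e < 1 / (4 * sqrt (real CARD('n))) \<Longrightarrow>
      infdist X (sign_stiefel S) \<le> 8 * sqrt (real CARD('n)) * e"
    and "infdist X (sign_stiefel S) \<le> 9 * real CARD('n) * e"
proof -
  define n where "n = real CARD('n)"
  have n: "1 \<le> sqrt n" and nn: "sqrt n * sqrt n = n"
    by (simp_all add: n_def)
  have e0: "0 \<le> e" and XQ: "norm (X - Q) \<le> e"
    by (simp_all add: e_def)
  have se: "e \<le> sqrt n * e"
    using mult_right_mono[OF n e0] by simp
  have ne: "sqrt n * e \<le> n * e"
    using mult_left_mono[OF se, of "sqrt n"] n nn by (simp flip: mult.assoc)
  show small: "infdist X (sign_stiefel S) \<le> 8 * sqrt (real CARD('n)) * e"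
    if e_small: "e < 1 / (4 * sqrt (real CARD('n)))"
  proof -
    have "norm (matrix_neg_part (S * Q)) \<le>
        norm (matrix_neg_part (S * X)) + norm (matrix_neg_part (S * Q) - matrix_neg_part (S * X))"
      by (rule norm_triangle_sub)
    also have "\<dots> \<le> norm (matrix_neg_part (S * X)) + norm (S * (Q - X))"
      using norm_matrix_neg_part_diff_le[of "S * Q" "S * X"] by (simp add: right_diff_distrib)
    also have "\<dots> = e"
      by (simp add: S_def e_def norm_sign_matrix_mult[OF PN] norm_minus_commute)
    finally have neg: "norm (matrix_neg_part (S * Q)) \<le> e" .
    obtain R where R: "orthogonal_matrix R" "0 \<le> R"
      "norm (S * Q - R) \<le> 5 * sqrt (real CARD('n)) * norm (matrix_neg_part (S * Q))"
      using orthogonal_matrix_near_permutation[of "S * Q"] le_less_trans[OF neg e_small]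
        orthogonal_matrix_sign_matrix_mult[OF PN Q] unfolding S_def by blast
    have "Q - S * R = S * (S * Q - R)"
      by (simp add: S_def right_diff_distrib sign_matrix_mult_self[OF PN])
    hence "norm (Q - S * R) = norm (S * Q - R)"
      by (simp add: S_def norm_sign_matrix_mult[OF PN])
    also have "\<dots> \<le> 5 * sqrt n * norm (matrix_neg_part (S * Q))"
      using R(3) by (simp add: n_def)
    also have "\<dots> \<le> 5 * sqrt n * e"
      by (rule mult_left_mono[OF neg]) (simp add: n_def)
    finally have QR: "norm (Q - S * R) \<le> 5 * sqrt n * e" .
    have "S * R \<in> sign_stiefel S"
      using R orthogonal_matrix_sign_matrix_mult[OF PN R(1)]
      by (simp add: sign_stiefel_def S_def sign_matrix_mult_self[OF PN] orthogonal_matrix)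
    hence "infdist X (sign_stiefel S) \<le> norm (X - S * R)"
      using infdist_le[of "S * R" "sign_stiefel S" X] by (simp add: dist_norm)
    also have "\<dots> \<le> norm (X - Q) + norm (Q - S * R)"
      using norm_triangle_ineq[of "X - Q" "Q - S * R"] by simp
    also have "\<dots> \<le> 8 * sqrt n * e"
      using XQ QR se e0 by linarith
    finally show ?thesis
      by (simp add: n_def)
  qed
  show "infdist X (sign_stiefel S) \<le> 9 * real CARD('n) * e"
  proof (cases "e < 1 / (4 * sqrt (real CARD('n)))")
    case True
    then show ?thesis
      using small[OF True] ne se e0 unfolding n_def by linarith
  next
    case False
    hence "1 \<le> 4 * (sqrt n * e)"
      using n by (simp add: n_def[symmetric] field_simps)
    hence "2 * sqrt n \<le> 2 * sqrt n * (4 * (sqrt n * e))"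
      using mult_left_mono[of 1 "4 * (sqrt n * e)" "2 * sqrt n"] n by linarith
    also have "\<dots> = 8 * n * e"
      using nn by (simp add: algebra_simps)
    finally have far: "2 * sqrt n \<le> 8 * n * e" .
    obtain R where R: "R \<in> sign_stiefel S"
      using sign_stiefel_nonempty[of P N] unfolding S_def by blast
    have "norm R = sqrt n"
      using R norm_orthogonal_matrix[of R] by (simp add: sign_stiefel_def orthogonal_matrix n_def)
    moreover have "norm Q = sqrt n"
      using norm_orthogonal_matrix[OF Q] by (simp add: n_def)
    moreover have "infdist X (sign_stiefel S) \<le> norm (X - R)"
      using infdist_le[OF R, of X] by (simp add: dist_norm)
    moreover have "norm (X - R) \<le> norm (X - Q) + (norm Q + norm R)"
      using norm_triangle_ineq[of "X - Q" "Q - R"] norm_triangle_ineq4[of Q R] by simp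
    ultimately show ?thesis
      using XQ far se ne unfolding n_def by linarith
  qed
qed

theorem theorem8:
  fixes X :: "real ^ 'n::{finite, linorder} ^ 'n::{finite, linorder}" and P N :: "'n set"
  assumes "P \<inter> N = {}" and "card P + card N = CARD('n)"
  shows "infdist X (sign_stiefel (sign_matrix P N)) \<le>
           9 * real CARD('n) *
             (norm (matrix_neg_part (sign_matrix P N * X)) + norm (singular_values X - 1))
       \<and> (norm (matrix_neg_part (sign_matrix P N * X)) + norm (singular_values X - 1)
             < 1 / (4 * sqrt (real CARD('n))) \<longrightarrow>
          infdist X (sign_stiefel (sign_matrix P N)) \<le>
           8 * sqrt (real CARD('n)) *
             (norm (matrix_neg_part (sign_matrix P N * X)) + norm (singular_values X - 1)))"
proof -
  have "card (P \<union> N) = CARD('n)"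
    using assms by (simp add: card_Un_disjoint)
  hence PN: "P \<union> N = UNIV"
    by (intro card_eq_UNIV_imp_eq_UNIV) auto
  obtain Q where Q: "orthogonal_matrix Q" and XQ: "norm (X - Q) = norm (singular_values X - 1)"
    using orthogonal_matrix_at_singular_value_distance[of X] by blast
  show ?thesis
    using infdist_sign_stiefel_le[OF PN Q, of X] unfolding XQ by blast
qed

end
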